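(* Let $u\in C^2([0,1])$ be a real-valued function, and let $m_2, M_2\in\mathbb{R}$ be such that $m_2\le u''(x)\le M_2$ for all $x\in[0,1]$. Let $0=x_0<x_1<\dots<x_{N+1}=1$ be a mesh of $[0,1]$ with mesh size $h=\max_{0\le i\le N}(x_{i+1}-x_i)$, and let $u_I$ be the $P_1$-interpolation polynomial of $u$ on this mesh. Then, for every integer $n\ge 1$, $$\|u-u_I\|_{1,1}\le \frac{h+h^2}{2}\,\|u''\|_{\infty}+\frac{h+h^2}{8n}\,(M_2-m_2).$$ In particular, letting $n\to+\infty$, $$\|u-u_I\|_{1,1}\le \frac{h+h^2}{2}\,\|u''\|_{\infty}.$$
   Context: The $P_1$-interpolation polynomial $u_I$ of $u$ on the mesh $(x_i)_{0\le i\le N+1}$ is the continuous function on $[0,1]$ such that $u_I(x_i)=u(x_i)$ for all $i\in\{0,\dots,N+1\}$ and the restriction of $u_I$ to each $[x_i,x_{i+1}]$ ($0\le i\le N$) is a polynomial of degree at most $1$. The norms are $\|v\|_{0,1}=\int_0^1|v(x)|\,dx$ and, for $v\in W^{1,1}(]0,1[)$, $\|v\|_{1,1}=\|v\|_{0,1}+\|v'\|_{0,1}$, where $v'$ is the weak derivative (for $v=u-u_I$ this is the classical derivative away from the mesh points). Also $\|u''\|_\infty=\operatorname{ess\,sup}_{x\in[0,1]}|u''(x)|$. *)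

theory Defs
  imports "HOL-Analysis.Analysis" "HOL-Probability.Essential_Supremum"
begin

definition mesh :: "nat \<Rightarrow> (nat \<Rightarrow> real) \<Rightarrow> bool" where
  "mesh N x \<longleftrightarrow> x 0 = 0 \<and> x (N + 1) = 1 \<and> (\<forall>i\<le>N. x i < x (i + 1))"

definition mesh_size :: "nat \<Rightarrow> (nat \<Rightarrow> real) \<Rightarrow> real" where
  "mesh_size N x = Max ((\<lambda>i. x (i + 1) - x i) ` {0..N})"

text \<open>The values of \<open>u\<^sub>I\<close> outside \<open>[0,1]\<close> are left unconstrained; nothing below depends on them.\<close>

definition P1_interpolant :: "nat \<Rightarrow> (nat \<Rightarrow> real) \<Rightarrow> (real \<Rightarrow> real) \<Rightarrow> (real \<Rightarrow> real) \<Rightarrow> bool" where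
  "P1_interpolant N x u u\<^sub>I \<longleftrightarrow>
     continuous_on {0..1} u\<^sub>I \<and>
     (\<forall>i\<le>N + 1. u\<^sub>I (x i) = u (x i)) \<and>
     (\<forall>i\<le>N. \<exists>p :: real poly. degree p \<le> 1 \<and> (\<forall>t\<in>{x i..x (i + 1)}. u\<^sub>I t = poly p t))"

text \<open>The space \<open>C\<^sub>c\<^sup>\<infinity>(]0,1[)\<close>; its members are extended by zero to the whole real line.\<close>

definition test_function :: "(real \<Rightarrow> real) \<Rightarrow> bool" where
  "test_function \<phi> \<longleftrightarrow>
     (\<forall>k t. (deriv ^^ k) \<phi> differentiable at t) \<and>
     compact (closure {t. \<phi> t \<noteq> 0}) \<and> closure {t. \<phi> t \<noteq> 0} \<subseteq> {0<..<1}"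

text \<open>\<open>g \<in> L\<^sup>1(]0,1[)\<close> is a weak derivative of \<open>v \<in> L\<^sup>1(]0,1[)\<close>.\<close>

definition has_weak_deriv :: "(real \<Rightarrow> real) \<Rightarrow> (real \<Rightarrow> real) \<Rightarrow> bool" where
  "has_weak_deriv v g \<longleftrightarrow>
     set_integrable lebesgue {0<..<1} v \<and> set_integrable lebesgue {0<..<1} g \<and>
     (\<forall>\<phi>. test_function \<phi> \<longrightarrow>
        (LINT t:{0<..<1}|lebesgue. v t * deriv \<phi> t) =
        - (LINT t:{0<..<1}|lebesgue. g t * \<phi> t))"

definition W11 :: "(real \<Rightarrow> real) set" where
  "W11 = {v. \<exists>g. has_weak_deriv v g}"

text \<open>For \<open>v \<in> W11\<close> the weak derivative is unique up to a null set. Outside \<open>W11\<close> the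
  choice is arbitrary, so statements about \<open>norm_1_1 v\<close> should come with \<open>v \<in> W11\<close>.\<close>

definition weak_deriv :: "(real \<Rightarrow> real) \<Rightarrow> real \<Rightarrow> real" where
  "weak_deriv v = (SOME g. has_weak_deriv v g)"

definition norm_0_1 :: "(real \<Rightarrow> real) \<Rightarrow> real" where
  "norm_0_1 v = (LINT t:{0..1}|lebesgue. \<bar>v t\<bar>)"

definition norm_1_1 :: "(real \<Rightarrow> real) \<Rightarrow> real" where
  "norm_1_1 v = norm_0_1 v + norm_0_1 (weak_deriv v)"

text \<open>The library's essential supremum takes values in a complete linear order, hence the
  detour through the extended reals. The result is meaningful for essentially bounded \<open>f\<close>,
  in particular for \<open>f\<close> continuous on \<open>[0,1]\<close>.\<close>

definition norm_sup :: "(real \<Rightarrow> real) \<Rightarrow> real" where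
  "norm_sup f = real_of_ereal (esssup (lebesgue_on {0..1}) (\<lambda>t. ereal \<bar>f t\<bar>))"

end

theory Submission
  imports Defs "HOL-Real_Asymp.Real_Asymp"
begin

text \<open>On each cell of the mesh, of length \<open>l\<close>, the error \<open>v = u - u\<^sub>I\<close> vanishes at both ends, so Rolle
  gives a zero \<open>\<xi>\<close> of \<open>v'\<close>, and \<open>v'' = u''\<close> yields \<open>\<bar>v' t\<bar> \<le> M * \<bar>t - \<xi>\<bar>\<close> with \<open>M = \<parallel>u''\<parallel>\<^sub>\<infinity>\<close>. Hence
  \<open>\<bar>v'\<bar>\<close> has integral at most \<open>M * l\<^sup>2 / 2\<close> over the cell, and \<open>\<bar>v\<bar> \<le> M * l\<^sup>2 / 2\<close> on it. Summing over
  the cells gives the bound without the \<open>1/n\<close> term, and the other one is weaker. The classical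
  derivative of \<open>v\<close> off the mesh points is a weak derivative by the fundamental theorem of calculus;
  it agrees almost everywhere with the chosen one by the fundamental lemma of the calculus of
  variations, for which bounded test functions converging to the indicators of intervals are needed.\<close>

section \<open>Smooth bump functions\<close>

lemma tendsto_poly_mult_exp_neg:
  fixes p :: "real poly"
  shows "((\<lambda>y. poly p y * exp (- y)) \<longlongrightarrow> 0) at_top"
proof -
  have "((\<lambda>y. \<Sum>i\<le>degree p. coeff p i * (y ^ i / exp y)) \<longlongrightarrow> (\<Sum>i\<le>degree p. coeff p i * 0)) at_top"
    by (intro tendsto_sum tendsto_mult tendsto_const tendsto_power_div_exp_0)
  then show ?thesis
    by (simp add: poly_altdef sum_distrib_right exp_minus divide_inverse mult.assoc)
qed

text \<open>For \<open>p = 1\<close> this is the classical smooth function \<open>exp (-1/x)\<close>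
  extended by zero. Allowing a polynomial in \<open>1/x\<close> as a factor makes the family closed
  under differentiation.\<close>

definition flat :: "real poly \<Rightarrow> real \<Rightarrow> real" where
  "flat p x = (if 0 < x then poly p (1 / x) * exp (- (1 / x)) else 0)"

lemma flat_smult: "flat (smult c p) x = c * flat p x"
  by (simp add: flat_def)

lemma flat_minus: "flat (- p) x = - flat p x"
  using flat_smult[of "-1" p x] by simp

text \<open>From the right, the substitution \<open>y = 1/x\<close> reduces the claim to the
  exponential outgrowing every polynomial at infinity.\<close>

lemma flat_tendsto_0: "(flat p \<longlongrightarrow> 0) (at 0)"
proof (subst filterlim_at_split, intro conjI)
  have "eventually (\<lambda>x. flat p x = 0) (at_left (0::real))"
    by (rule eventually_at_leftI[of "-1"]) (auto simp: flat_def)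
  then show "(flat p \<longlongrightarrow> 0) (at_left 0)"
    by (rule tendsto_eventually)
  have "((\<lambda>x. poly p (inverse x) * exp (- inverse x)) \<longlongrightarrow> 0) (at_right 0)"
    by (rule filterlim_compose[OF tendsto_poly_mult_exp_neg filterlim_inverse_at_top_right])
  moreover have "eventually (\<lambda>x. poly p (inverse x) * exp (- inverse x) = flat p x) (at_right (0::real))"
    by (rule eventually_at_rightI[of _ 1]) (auto simp: flat_def inverse_eq_divide)
  ultimately show "(flat p \<longlongrightarrow> 0) (at_right 0)"
    by (rule Lim_transform_eventually)
qed

text \<open>With \<open>y = 1/x\<close>, whose derivative is \<open>-y^2\<close>, the chain rule
  turns \<open>p(y) * exp(-y)\<close> into \<open>y^2 * (p(y) - p'(y)) * exp(-y)\<close>; the two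
  \<open>pCons 0\<close> supply the factor \<open>y^2\<close>.\<close>

definition flat_deriv :: "real poly \<Rightarrow> real poly" where
  "flat_deriv p = pCons 0 (pCons 0 (p - pderiv p))"

lemma DERIV_flat: "(flat p has_real_derivative flat (flat_deriv p) x) (at x)"
proof -
  consider "x > 0" | "x < 0" | "x = 0" by linarith
  then show ?thesis
  proof cases
    case 1
    have "((\<lambda>x. poly p (1 / x) * exp (- (1 / x))) has_real_derivative flat (flat_deriv p) x) (at x)"
    proof -
      have D: "((\<lambda>x. 1 / x) has_real_derivative - (1 / x * (1 / x))) (at x)"
        using 1 by (auto intro!: derivative_eq_intros)
      show ?thesis
        using DERIV_mult[OF DERIV_chain2[OF poly_DERIV D] DERIV_chain2[OF DERIV_exp DERIV_minus[OF D]]] 1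
        by (simp add: flat_def flat_deriv_def algebra_simps)
    qed
    then show ?thesis
      by (rule has_field_derivative_transform_within_open[where S = "{0<..}"])
        (use 1 in \<open>auto simp: flat_def\<close>)
  next
    case 2
    have "((\<lambda>x. 0) has_real_derivative flat (flat_deriv p) x) (at x)"
      using 2 by (simp add: flat_def)
    then show ?thesis
      by (rule has_field_derivative_transform_within_open[where S = "{..<0}"])
        (use 2 in \<open>auto simp: flat_def\<close>)
  next
    case 3
    \<comment> \<open>Dividing by \<open>h\<close> multiplies the polynomial by its variable
      \<open>1/h\<close>, so the difference quotient stays in the family and tends to zero.\<close>
    have "(flat p h - flat p 0) / (h - 0) = flat (pCons 0 p) h" for h
      by (simp add: flat_def)
    then have "(flat p has_real_derivative 0) (at 0)"
      unfolding has_field_derivative_iff by (simp only: flat_tendsto_0)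
    then show ?thesis
      using 3 by (simp add: flat_def)
  qed
qed

text \<open>A set of functions closed under differentiation witnesses smoothness without a Leibniz rule
  for higher derivatives.\<close>

inductive_set flat_span :: "real \<Rightarrow> real \<Rightarrow> real \<Rightarrow> (real \<Rightarrow> real) set" for k a b where
  prod: "(\<lambda>t. flat p (k * t - a) * flat q (b - k * t)) \<in> flat_span k a b"
| add: "f \<in> flat_span k a b \<Longrightarrow> g \<in> flat_span k a b \<Longrightarrow> (\<lambda>t. f t + g t) \<in> flat_span k a b"

lemma flat_span_deriv:
  assumes "f \<in> flat_span k a b"
  shows "\<exists>f' \<in> flat_span k a b. \<forall>t. (f has_real_derivative f' t) (at t)"
  using assms
proof induction
  case (prod p q)
  \<comment> \<open>The inner derivatives \<open>k\<close> and \<open>-k\<close> are absorbed into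
    the polynomials, so \<open>flat_span\<close> need not be closed under scalar multiples.\<close>
  let ?f = "\<lambda>t. flat (smult k (flat_deriv p)) (k * t - a) * flat q (b - k * t)
              + flat p (k * t - a) * flat (smult (- k) (flat_deriv q)) (b - k * t)"
  have "((\<lambda>t. flat p (k * t - a) * flat q (b - k * t)) has_real_derivative ?f t) (at t)" for t
  proof -
    have "((\<lambda>t. k * t - a) has_real_derivative k) (at t)" "((\<lambda>t. b - k * t) has_real_derivative - k) (at t)"
      by (auto intro!: derivative_eq_intros)
    from DERIV_mult[OF DERIV_chain2[OF DERIV_flat this(1)] DERIV_chain2[OF DERIV_flat this(2)], of p q]
    show ?thesis by (simp add: flat_smult flat_minus algebra_simps)
  qed
  moreover have "?f \<in> flat_span k a b"
    by (intro flat_span.intros)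
  ultimately show ?case by (intro bexI[of _ ?f] allI)
next
  case (add f g)
  then obtain f' g' where "f' \<in> flat_span k a b" "g' \<in> flat_span k a b"
    "\<forall>t. (f has_real_derivative f' t) (at t)" "\<forall>t. (g has_real_derivative g' t) (at t)"
    by blast
  then show ?case
    by (intro bexI[of _ "\<lambda>t. f' t + g' t"]) (auto intro: flat_span.add DERIV_add)
qed

lemma funpow_deriv_closed:
  assumes step: "\<And>f. f \<in> S \<Longrightarrow> \<exists>f' \<in> S. \<forall>t. (f has_real_derivative f' t) (at t)"
    and "f \<in> S"
  shows "(deriv ^^ k) f \<in> S"
proof (induction k)
  case (Suc k)
  then obtain f' where "f' \<in> S" "\<forall>t. ((deriv ^^ k) f has_real_derivative f' t) (at t)"
    using step by blast
  moreover from this have "deriv ((deriv ^^ k) f) = f'"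
    by (auto intro: DERIV_imp_deriv)
  ultimately show ?case by simp
qed (simp add: \<open>f \<in> S\<close>)

text \<open>Supported in \<open>[1/n, c - 1/n]\<close>. Rescaling the argument by \<open>n\<close> pushes both factors
  \<open>exp (-1/y)\<close> towards \<open>1\<close> inside the support.\<close>

definition bump :: "real \<Rightarrow> nat \<Rightarrow> real \<Rightarrow> real" where
  "bump c n t = flat 1 (real n * t - 1) * flat 1 ((real n * c - 1) - real n * t)"

lemma test_function_bump:
  assumes "0 < n" "c \<le> 1"
  shows "test_function (bump c n)"
proof -
  have S: "bump c n \<in> flat_span (real n) 1 (real n * c - 1)"
    unfolding bump_def by (rule flat_span.prod)
  have "(deriv ^^ k) (bump c n) differentiable at t" for k t
    using flat_span_deriv[OF funpow_deriv_closed[OF flat_span_deriv S, of k]]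
    by (auto simp: real_differentiable_def)
  moreover have sub: "closure {t. bump c n t \<noteq> 0} \<subseteq> {1 / real n .. c - 1 / real n}"
    using assms by (intro closure_minimal) (auto simp: bump_def flat_def field_simps split: if_splits)
  moreover have "{1 / real n .. c - 1 / real n} \<subseteq> {0<..<1}"
  proof
    fix t assume "t \<in> {1 / real n .. c - 1 / real n}"
    then have "1 / real n \<le> t" "t \<le> c - 1 / real n" by auto
    moreover have "1 / real n > 0" using assms by simp
    ultimately have "0 < t" "t < 1" using \<open>c \<le> 1\<close> by linarith+
    then show "t \<in> {0<..<1}" by simp
  qed
  moreover have "compact (closure {t. bump c n t \<noteq> 0})"
    using sub by (meson bounded_closed_interval bounded_subset closed_closure compact_eq_bounded_closed)
  ultimately show ?thesis
    unfolding test_function_def by blast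
qed

lemma continuous_bump: "continuous_on A (bump c n)"
proof -
  have "isCont (flat p) x" for p x
    using DERIV_flat DERIV_isCont by blast
  then have "continuous_on UNIV (flat 1)"
    by (simp add: continuous_at_imp_continuous_on)
  note flat = continuous_on_compose2[OF this _ subset_UNIV]
  show ?thesis
    unfolding bump_def
    by (rule continuous_on_mult; rule flat; intro continuous_intros)
qed

lemma abs_bump_le_1: "\<bar>bump c n t\<bar> \<le> 1"
proof -
  have "0 \<le> flat 1 x \<and> flat 1 x \<le> 1" for x
    by (simp add: flat_def)
  then show ?thesis
    unfolding bump_def by (simp add: abs_mult mult_le_one)
qed

lemma flat_1_tendsto_1:
  assumes "filterlim f at_top F"
  shows "((\<lambda>n. flat 1 (f n)) \<longlongrightarrow> 1) F"
proof -
  have "((\<lambda>n. exp (- inverse (f n))) \<longlongrightarrow> exp (- 0)) F"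
    by (intro tendsto_intros tendsto_inverse_0_at_top assms)
  moreover have "eventually (\<lambda>n. exp (- inverse (f n)) = flat 1 (f n)) F"
    using assms[unfolded filterlim_at_top_dense, rule_format, of 0]
    by eventually_elim (simp add: flat_def inverse_eq_divide)
  ultimately show ?thesis
    by (auto intro: Lim_transform_eventually)
qed

text \<open>Inside the interval both arguments, \<open>n * t - 1\<close> and
  \<open>n * (c - t) - 1\<close>, tend to infinity, where \<open>flat 1\<close> tends to 1. Outside,
  one of them is negative for every \<open>n\<close>, so the bump vanishes.\<close>

lemma bump_tendsto_indicator: "(\<lambda>n. bump c n t) \<longlonglongrightarrow> indicator {0<..<c} t"
proof (cases "t \<in> {0<..<c}")
  case True
  have lim: "filterlim (\<lambda>n. real n * d - 1) at_top sequentially" if "d > 0" for d :: real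
    using that by real_asymp
  have "filterlim (\<lambda>n. (real n * c - 1) - real n * t) at_top sequentially"
    using lim[of "c - t"] True by (simp add: algebra_simps)
  then have "(\<lambda>n. bump c n t) \<longlonglongrightarrow> 1 * 1"
    unfolding bump_def using True by (intro tendsto_mult flat_1_tendsto_1 lim) auto
  then show ?thesis using True by simp
next
  case False
  have "bump c n t = 0" for n
  proof (cases "t \<le> 0")
    case True
    then have "real n * t - 1 \<le> 0"
      using mult_nonneg_nonpos[of "real n" t] by simp
    then show ?thesis by (simp add: bump_def flat_def)
  next
    case False
    with \<open>t \<notin> _\<close> have "(real n * c - 1) - real n * t \<le> 0"
      using mult_left_mono[of c t "real n"] by auto
    then show ?thesis by (simp add: bump_def flat_def)
  qed
  then show ?thesis using False by simp
qed

section \<open>Weak derivatives\<close>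

text \<open>A countable cover by sets of finite measure keeps its measures under completion. This
  makes \<open>density_zero\<close> applicable to \<open>lebesgue\<close>.\<close>

lemma sigma_finite_completion:
  assumes "sigma_finite_measure M"
  shows "sigma_finite_measure (completion M)"
proof
  obtain \<A> where \<A>: "countable \<A>" "\<A> \<subseteq> sets M" "\<Union>\<A> = space M" "\<forall>a\<in>\<A>. emeasure M a \<noteq> \<infinity>"
    using sigma_finite_measure.sigma_finite_countable[OF assms] by metis
  then have "\<A> \<subseteq> sets (completion M)" "\<forall>a\<in>\<A>. emeasure (completion M) a \<noteq> \<infinity>"
    by (auto simp: subset_eq)
  with \<A> show "\<exists>\<A>. countable \<A> \<and> \<A> \<subseteq> sets (completion M) \<and> \<Union>\<A> = space (completion M)
      \<and> (\<forall>a\<in>\<A>. emeasure (completion M) a \<noteq> \<infinity>)"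
    by (intro exI[of _ \<A>]) simp
qed

text \<open>The fundamental lemma of the calculus of variations. Bumps give zero integrals over the
  intervals \<open>{0<..<c}\<close>, a pi-lambda argument extends this to Borel sets, and completion
  to Lebesgue sets; a function with all these integrals zero vanishes almost everywhere.\<close>

lemma AE_eq_0_if_integral_test_function_eq_0:
  assumes d: "set_integrable lebesgue {0<..<1} d"
    and zero: "\<And>\<phi>. test_function \<phi> \<Longrightarrow> (LINT t:{0<..<1}|lebesgue. d t * \<phi> t) = 0"
  shows "AE t\<in>{0<..<1} in lebesgue. d t = 0"
proof -
  \<comment> \<open>Extension by zero allows integration over arbitrary sets of the real
    line.\<close>
  define D where "D t = indicator {0<..<1} t * d t" for t :: real
  have D: "integrable lebesgue D"
    using d by (simp add: set_integrable_def D_def[abs_def])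
  have D_int: "set_integrable lebesgue A D" if "A \<in> sets lebesgue" for A :: "real set"
    using integrable_mult_indicator[OF that D] by (simp add: set_integrable_def)
  \<comment> \<open>A nonpositive \<open>c\<close> is allowed and gives the empty interval, which
    saves a case distinction for half-lines below.\<close>
  have I: "(LINT t:{0<..<c}|lebesgue. D t) = 0" if "c \<le> 1" for c
  proof -
    \<comment> \<open>The index starts at 1 because \<open>test_function_bump\<close> requires
      \<open>0 < n\<close>. Bumps are bounded by 1, so the norm of \<open>D\<close>
      dominates.\<close>
    have "(\<lambda>n. LINT t|lebesgue. D t * bump c (Suc n) t) \<longlonglongrightarrow> (LINT t|lebesgue. D t * indicator {0<..<c} t)"
    proof (rule integral_dominated_convergence[where w = "\<lambda>t. norm (D t)"])
      have "bump c n \<in> borel_measurable lebesgue" for n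
        using borel_measurable_continuous_onI[OF continuous_bump] by (simp add: measurable_completion)
      then show "(\<lambda>t. D t * bump c (Suc n) t) \<in> borel_measurable lebesgue" for n
        using D by (intro borel_measurable_times) auto
      show "AE t in lebesgue. (\<lambda>n. D t * bump c (Suc n) t) \<longlonglongrightarrow> D t * indicator {0<..<c} t"
        by (intro AE_I2 tendsto_intros LIMSEQ_Suc bump_tendsto_indicator)
      show "AE t in lebesgue. norm (D t * bump c (Suc n) t) \<le> norm (D t)" for n
        using abs_bump_le_1 by (intro AE_I2) (simp add: abs_mult mult_left_le)
      show "(\<lambda>t. D t * indicator {0<..<c} t) \<in> borel_measurable lebesgue"
        using D by (intro borel_measurable_times borel_measurable_indicator) auto
    qed (use D in auto)
    moreover have "(LINT t|lebesgue. D t * bump c (Suc n) t) = 0" for n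
      using zero[OF test_function_bump[OF _ that, of "Suc n"]]
      by (simp add: set_lebesgue_integral_def D_def mult.assoc)
    ultimately have "(LINT t|lebesgue. D t * indicator {0<..<c} t) = 0"
      by (simp add: LIMSEQ_const_iff)
    then show ?thesis by (simp add: set_lebesgue_integral_def mult.commute)
  qed
  \<comment> \<open>The total integral is what the complement case of the induction needs.\<close>
  have D01: "(LINT t|lebesgue. D t) = 0"
  proof -
    have "indicator {0<..<1} t * D t = D t" for t
      by (simp add: D_def indicator_def)
    with I[of 1] show ?thesis by (simp add: set_lebesgue_integral_def)
  qed
  \<comment> \<open>The half-lines form an intersection-stable generator, and vanishing of the
    integral passes to complements and countable disjoint unions.\<close>
  have borel: "(LINT t:A|lebesgue. D t) = 0" if "A \<in> sets borel" for A
  proof -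
    have 1: "Int_stable (range (lessThan :: real \<Rightarrow> real set))"
    proof -
      have "{..<a} \<inter> {..<b} = {..<min a b}" for a b :: real by auto
      then show ?thesis by (force simp: Int_stable_def)
    qed
    have 2: "range (lessThan :: real \<Rightarrow> real set) \<subseteq> Pow UNIV" by simp
    have b: "sigma_sets UNIV (range lessThan) = sets (borel :: real measure)"
      unfolding borel_Iio by (rule sets_measure_of[symmetric]) simp
    have leb: "B \<in> sets lebesgue" if "B \<in> sigma_sets UNIV (range lessThan)" for B :: "real set"
      using that unfolding b by simp
    have 3: "A \<in> sigma_sets UNIV (range lessThan)" unfolding b by (rule that)
    show ?thesis
      using 1 2 3
    proof (induction rule: sigma_sets_induct_disjoint)
      case (basic A)
      then obtain a where A: "A = {..<a}" by auto
      have "indicator A t * D t = indicator {0<..<min a 1} t * D t" for t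
        by (auto simp: A D_def indicator_def)
      then show ?case
        using I[of "min a 1"] by (simp only: set_lebesgue_integral_def real_scaleR_def)
    next
      case empty
      then show ?case by (simp add: set_lebesgue_integral_def)
    next
      case (compl A)
      have "A \<in> sets lebesgue" using compl(1) by (rule leb)
      have "(LINT t:UNIV - A|lebesgue. D t) = (LINT t|lebesgue. D t - indicator A t * D t)"
        unfolding set_lebesgue_integral_def
        by (intro Bochner_Integration.integral_cong) (auto simp: indicator_def)
      also have "\<dots> = 0"
        using D D_int[OF \<open>A \<in> sets lebesgue\<close>] D01 compl(2)
        by (simp add: set_integrable_def set_lebesgue_integral_def)
      finally show ?case .
    next
      case (union A)
      have "A i \<in> sets lebesgue" for i using union(2) by (intro leb) auto
      then have "(LINT t:(\<Union>i. A i)|lebesgue. D t) = (\<Sum>i. (LINT t:A i|lebesgue. D t))"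
        using disjoint_family_onD[OF union(1)]
        by (intro lebesgue_integral_countable_add D_int sets.countable_UN) auto
      then show ?case using union(3) by simp
    qed
  qed
  have "AE t in lebesgue. D t = 0"
  proof (rule sigma_finite_measure.density_zero[OF _ D])
    show "sigma_finite_measure (lebesgue :: real measure)"
      by (intro sigma_finite_completion sigma_finite_lborel)
  next
    fix A :: "real set" assume "A \<in> sets lebesgue"
    \<comment> \<open>A Lebesgue set differs from a Borel set only within a null set, which does not
      affect the integral.\<close>
    then obtain S N N' where A: "A = S \<union> N" "N \<subseteq> N'" "N' \<in> null_sets lborel" "S \<in> sets lborel"
      by (rule sets_completionE)
    have "AE t in lebesgue. t \<notin> N'"
      using A by (intro AE_not_in null_sets_completionI)
    then have "(LINT t:A|lebesgue. D t) = (LINT t:S|lebesgue. D t)"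
      unfolding set_lebesgue_integral_def
    proof (intro integral_cong_AE)
      show "AE t in lebesgue. indicator A t *\<^sub>R D t = indicator S t *\<^sub>R D t"
        using \<open>AE t in lebesgue. t \<notin> N'\<close>
        by eventually_elim (use A in \<open>auto simp: indicator_def\<close>)
    qed (use A \<open>A \<in> sets lebesgue\<close> D_int[of A] D_int[of S] in \<open>auto simp: set_integrable_def\<close>)
    then show "(LINT t:A|lebesgue. D t) = 0"
      using borel[of S] A by simp
  qed
  then show ?thesis
    by eventually_elim (auto simp: D_def)
qed

section \<open>Integration by parts for piecewise differentiable functions\<close>

lemma test_function_deriv:
  assumes "test_function \<phi>"
  shows "(\<phi> has_real_derivative deriv \<phi> t) (at t)"
    and "continuous_on A \<phi>" and "continuous_on A (deriv \<phi>)"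
proof -
  have diff: "(deriv ^^ k) \<phi> differentiable at t" for k t
    using assms by (simp add: test_function_def)
  show D: "(\<phi> has_real_derivative deriv \<phi> t) (at t)" for t
    using diff[of 0 t] by (simp add: DERIV_deriv_iff_real_differentiable)
  show "continuous_on A \<phi>"
    using D DERIV_isCont by (blast intro: continuous_at_imp_continuous_on)
  show "continuous_on A (deriv \<phi>)"
    using diff[of 1] by (auto intro!: continuous_at_imp_continuous_on differentiable_imp_continuous_within)
qed

lemma absolutely_integrable_Ioo_iff:
  fixes f :: "real \<Rightarrow> real"
  shows "f absolutely_integrable_on {a<..<b} \<longleftrightarrow> f absolutely_integrable_on {a..b}"
  using absolutely_integrable_on_open_interval[where f = f and a = a and b = b] by simp

lemma absolutely_integrable_mult_test_function:
  assumes "test_function \<phi>" "g absolutely_integrable_on {0<..<1}"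
  shows "(\<lambda>t. g t * \<phi> t) absolutely_integrable_on {0<..<1}"
proof -
  have "(\<lambda>t. \<phi> t * g t) absolutely_integrable_on {0..1}"
    using assms test_function_deriv(2)
    by (intro absolutely_integrable_bounded_measurable_product_real
        continuous_imp_measurable_on_sets_lebesgue compact_imp_bounded compact_continuous_image)
      (auto simp: absolutely_integrable_Ioo_iff)
  then show ?thesis
    by (simp add: mult.commute absolutely_integrable_Ioo_iff)
qed

text \<open>The fundamental theorem is applied to \<open>v * \<phi>\<close>, whose continuity makes
  the finite exceptional set harmless. The boundary terms vanish because the support of
  \<open>\<phi>\<close> avoids 0 and 1.\<close>

lemma has_weak_deriv_piecewise:
  assumes "finite S" and v: "continuous_on {0..1} v"
    and der: "\<And>t. t \<in> {0<..<1} - S \<Longrightarrow> (v has_real_derivative g t) (at t)"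
    and g: "g absolutely_integrable_on {0<..<1}"
  shows "has_weak_deriv v g"
proof -
  have v_int: "v absolutely_integrable_on {0<..<1}"
    using absolutely_integrable_continuous_real[OF v] by (simp add: absolutely_integrable_Ioo_iff)
  have "(LINT t:{0<..<1}|lebesgue. v t * deriv \<phi> t) = - (LINT t:{0<..<1}|lebesgue. g t * \<phi> t)"
    if \<phi>: "test_function \<phi>" for \<phi>
  proof -
    note D = test_function_deriv[OF \<phi>]
    have "0 \<notin> closure {t. \<phi> t \<noteq> 0}" "1 \<notin> closure {t. \<phi> t \<noteq> 0}"
      using \<phi> by (auto simp: test_function_def)
    then have \<phi>01: "\<phi> 0 = 0" "\<phi> 1 = 0"
      using closure_subset[of "{t. \<phi> t \<noteq> 0}"] by auto
    have "(\<lambda>t. v t * deriv \<phi> t) absolutely_integrable_on {0..1}"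
      by (intro absolutely_integrable_continuous_real continuous_intros v D)
    then have i1: "(\<lambda>t. v t * deriv \<phi> t) absolutely_integrable_on {0<..<1}"
      by (simp add: absolutely_integrable_Ioo_iff)
    have i2: "(\<lambda>t. g t * \<phi> t) absolutely_integrable_on {0<..<1}"
      by (intro absolutely_integrable_mult_test_function \<phi> g)
    have "((\<lambda>t. v t * deriv \<phi> t + g t * \<phi> t) has_integral v 1 * \<phi> 1 - v 0 * \<phi> 0) {0..1}"
    proof (rule fundamental_theorem_of_calculus_interior_strong[OF \<open>finite S\<close>])
      show "((\<lambda>t. v t * \<phi> t) has_vector_derivative v t * deriv \<phi> t + g t * \<phi> t) (at t)"
        if "t \<in> {0<..<1} - S" for t
        using DERIV_mult'[OF der[OF that] D(1)]
        by (simp add: has_real_derivative_iff_has_vector_derivative)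
    qed (auto intro!: continuous_intros v D)
    then have "integral {0..1} (\<lambda>t. v t * deriv \<phi> t + g t * \<phi> t) = 0"
      by (simp add: \<phi>01 integral_unique)
    then have "0 = integral {0<..<1} (\<lambda>t. v t * deriv \<phi> t + g t * \<phi> t)"
      by (simp add: integral_open_interval_real)
    also have "\<dots> = integral {0<..<1} (\<lambda>t. v t * deriv \<phi> t) + integral {0<..<1} (\<lambda>t. g t * \<phi> t)"
      using i1 i2 by (intro Henstock_Kurzweil_Integration.integral_add set_lebesgue_integral_eq_integral(1))
    finally show ?thesis
      using set_lebesgue_integral_eq_integral(2)[OF i1] set_lebesgue_integral_eq_integral(2)[OF i2]
      by simp
  qed
  then show ?thesis
    using v_int g by (auto simp: has_weak_deriv_def)
qed

section \<open>The norm of the weak derivative\<close>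

text \<open>The end points are null. This links the norm over the closed interval to the open one on
  which weak derivatives live, and to the gauge integral used for the estimates.\<close>

lemma norm_0_1_eq_Ioo:
  assumes "g absolutely_integrable_on {0<..<1}"
  shows "norm_0_1 g = (LINT t:{0<..<1}|lebesgue. \<bar>g t\<bar>)"
    and "norm_0_1 g = integral {0..1} (\<lambda>t. \<bar>g t\<bar>)"
proof -
  have i: "(\<lambda>t. \<bar>g t\<bar>) absolutely_integrable_on {0<..<1}"
    using absolutely_integrable_norm[OF assms] by (simp add: o_def)
  then have "(\<lambda>t. \<bar>g t\<bar>) absolutely_integrable_on {0..1}"
    by (simp add: absolutely_integrable_Ioo_iff)
  from set_lebesgue_integral_eq_integral(2)[OF this]
  show 1: "norm_0_1 g = integral {0..1} (\<lambda>t. \<bar>g t\<bar>)"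
    by (simp add: norm_0_1_def)
  from set_lebesgue_integral_eq_integral(2)[OF i] show "norm_0_1 g = (LINT t:{0<..<1}|lebesgue. \<bar>g t\<bar>)"
    by (simp add: 1 integral_open_interval_real)
qed

lemma has_weak_deriv_unique:
  assumes "has_weak_deriv v g1" "has_weak_deriv v g2"
  shows "AE t\<in>{0<..<1} in lebesgue. g1 t = g2 t"
proof -
  have i: "g1 absolutely_integrable_on {0<..<1}" "g2 absolutely_integrable_on {0<..<1}"
    using assms by (auto simp: has_weak_deriv_def)
  have "AE t\<in>{0<..<1} in lebesgue. g1 t - g2 t = 0"
  proof (rule AE_eq_0_if_integral_test_function_eq_0)
    show "(\<lambda>t. g1 t - g2 t) absolutely_integrable_on {0<..<1}"
      by (intro set_integral_diff i)
    fix \<phi> assume \<phi>: "test_function \<phi>"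
    have "(LINT t:{0<..<1}|lebesgue. v t * deriv \<phi> t) = - (LINT t:{0<..<1}|lebesgue. g t * \<phi> t)"
      if "has_weak_deriv v g" for g
      using that \<phi> unfolding has_weak_deriv_def by blast
    from this[OF assms(1)] this[OF assms(2)]
    have "(LINT t:{0<..<1}|lebesgue. g1 t * \<phi> t) = (LINT t:{0<..<1}|lebesgue. g2 t * \<phi> t)"
      by simp
    then show "(LINT t:{0<..<1}|lebesgue. (g1 t - g2 t) * \<phi> t) = 0"
      using set_integral_diff(2)[OF absolutely_integrable_mult_test_function[OF \<phi> i(1)]
          absolutely_integrable_mult_test_function[OF \<phi> i(2)]]
      by (simp add: left_diff_distrib)
  qed
  then show ?thesis by simp
qed

text \<open>The weak derivative is picked by Hilbert choice; by uniqueness almost everywhere, its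
  norm can be computed from any explicit \<open>g\<close>.\<close>

lemma norm_0_1_weak_deriv:
  assumes "has_weak_deriv v g"
  shows "norm_0_1 (weak_deriv v) = norm_0_1 g"
proof -
  have w: "has_weak_deriv v (weak_deriv v)"
    unfolding weak_deriv_def by (rule someI[of _ g]) (rule assms)
  have i: "weak_deriv v absolutely_integrable_on {0<..<1}" "g absolutely_integrable_on {0<..<1}"
    using w assms by (auto simp: has_weak_deriv_def)
  have m: "(\<lambda>t. indicator {0<..<1} t *\<^sub>R \<bar>f t\<bar>) \<in> borel_measurable lebesgue"
    if "f absolutely_integrable_on {0<..<1}" for f :: "real \<Rightarrow> real"
    using absolutely_integrable_norm[OF that]
    by (auto simp: o_def set_integrable_def)
  have "(LINT t:{0<..<1}|lebesgue. \<bar>weak_deriv v t\<bar>) = (LINT t:{0<..<1}|lebesgue. \<bar>g t\<bar>)"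
    unfolding set_lebesgue_integral_def
  proof (rule integral_cong_AE)
    show "AE t in lebesgue. indicator {0<..<1} t *\<^sub>R \<bar>weak_deriv v t\<bar> = indicator {0<..<1} t *\<^sub>R \<bar>g t\<bar>"
      using has_weak_deriv_unique[OF w assms] by eventually_elim (auto simp: indicator_def)
  qed (intro m i)+
  then show ?thesis by (simp add: norm_0_1_eq_Ioo(1) i)
qed

section \<open>Estimates on one cell\<close>

text \<open>The bound holds almost everywhere. By continuity the points satisfying it form a closed
  set, which therefore contains the open interval and then its closure.\<close>

lemma abs_le_norm_sup:
  assumes f: "continuous_on {0..1} f" and t: "t \<in> {0..1}"
  shows "\<bar>f t\<bar> \<le> norm_sup f"
proof -
  let ?M = "lebesgue_on {0..1::real}"
  let ?E = "esssup ?M (\<lambda>t. ereal \<bar>f t\<bar>)"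
  have [measurable]: "f \<in> borel_measurable ?M"
    using f by (intro continuous_imp_measurable_on_sets_lebesgue) auto
  have meas: "(\<lambda>t. ereal \<bar>f t\<bar>) \<in> borel_measurable ?M" by measurable
  obtain B where B: "\<And>t. t \<in> {0..1} \<Longrightarrow> \<bar>f t\<bar> \<le> B"
    using compact_imp_bounded[OF compact_continuous_image[OF f]] by (force simp: bounded_iff)
  \<comment> \<open>Bounds on both sides exclude infinite values, which \<open>real_of_ereal\<close>
    would map to 0.\<close>
  have "?E \<le> ereal B"
    using B by (intro esssup_I meas AE_I2) (auto simp: space_restrict_space)
  moreover have "0 \<le> ?E"
  proof -
    have "emeasure ?M (space ?M) \<noteq> 0"
      by (simp add: emeasure_restrict_space space_restrict_space)
    then have "0 = esssup ?M (\<lambda>t. 0 :: ereal)" by (simp add: esssup_const)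
    also have "\<dots> \<le> ?E" by (intro esssup_mono) auto
    finally show ?thesis .
  qed
  ultimately have E: "?E = ereal (norm_sup f)"
    unfolding norm_sup_def by (cases ?E) auto
  let ?C = "{t \<in> {0..1}. \<bar>f t\<bar> \<in> {..norm_sup f}}"
  have "closed ?C"
    using f by (intro continuous_closed_preimage[unfolded vimage_def Int_def mem_Collect_eq] continuous_intros) auto
  moreover have "AE t\<in>{0<..<1} in lebesgue. t \<in> ?C"
    using esssup_AE[where M = ?M and f = "\<lambda>t. ereal \<bar>f t\<bar>"] unfolding E
    by (subst (asm) AE_restrict_space_iff) (auto elim!: eventually_mono)
  ultimately have "{0<..<1} \<subseteq> ?C"
    by (intro subsetI mem_closed_if_AE_lebesgue_open[of "{0<..<1}" ?C]) (rule open_greaterThanLessThan)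
  then have "closure {0<..<1} \<subseteq> ?C"
    using \<open>closed ?C\<close> by (rule closure_minimal)
  then show ?thesis using t by auto
qed

lemma abs_diff_le_mvt:
  fixes f f' :: "real \<Rightarrow> real"
  assumes "a \<le> b" "continuous_on {a..b} f"
    and "\<And>t. a < t \<Longrightarrow> t < b \<Longrightarrow> (f has_real_derivative f' t) (at t)"
    and "\<And>t. a < t \<Longrightarrow> t < b \<Longrightarrow> \<bar>f' t\<bar> \<le> B"
  shows "\<bar>f b - f a\<bar> \<le> B * (b - a)"
proof (cases "a = b")
  case False
  then obtain l z where z: "a < z" "z < b" "(f has_real_derivative l) (at z)" "f b - f a = (b - a) * l"
    using MVT[of a b f] assms by (metis order_le_less real_differentiable_def)
  then have "\<bar>l\<bar> \<le> B" using assms(3,4) DERIV_unique by metis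
  then show ?thesis
    using z assms(1) by (simp add: abs_mult mult.commute mult_left_mono)
qed simp

lemma abs_deriv_le_Rolle:
  fixes v g d :: "real \<Rightarrow> real"
  assumes "a < b" "continuous_on {a..b} v" "v a = v b"
    and v: "\<And>t. a < t \<Longrightarrow> t < b \<Longrightarrow> (v has_real_derivative g t) (at t)"
    and g: "\<And>t. a < t \<Longrightarrow> t < b \<Longrightarrow> (g has_real_derivative d t) (at t)"
    and d: "\<And>t. a < t \<Longrightarrow> t < b \<Longrightarrow> \<bar>d t\<bar> \<le> M"
  obtains \<xi> where "a < \<xi>" "\<xi> < b" "\<And>t. a < t \<Longrightarrow> t < b \<Longrightarrow> \<bar>g t\<bar> \<le> M * \<bar>t - \<xi>\<bar>"
proof -
  obtain \<xi> where \<xi>: "a < \<xi>" "\<xi> < b" "(v has_real_derivative 0) (at \<xi>)"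
    using Rolle[of a b v] assms(1-3) v by (metis real_differentiable_def)
  then have g0: "g \<xi> = 0" using v DERIV_unique by blast
  \<comment> \<open>Nothing is known about \<open>g\<close> at the ends of the cell, so the mean
    value theorem is applied on compact subintervals of the open cell.\<close>
  have cont: "continuous_on {p..q} g" if "a < p" "q < b" for p q
    using that g by (intro continuous_at_imp_continuous_on ballI DERIV_isCont[OF g]) auto
  have "\<bar>g t\<bar> \<le> M * \<bar>t - \<xi>\<bar>" if "a < t" "t < b" for t
  proof (cases "\<xi> \<le> t")
    case True
    then show ?thesis
      using abs_diff_le_mvt[of \<xi> t g d M] cont[of \<xi> t] g d \<xi> that g0 by fastforce
  next
    case False
    then show ?thesis
      using abs_diff_le_mvt[of t \<xi> g d M] cont[of t \<xi>] g d \<xi> that g0 by fastforce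
  qed
  with that \<xi> show ?thesis by blast
qed

text \<open>The antiderivative is \<open>(t - \<xi>) * \<bar>t - \<xi>\<bar> / 2\<close>; treating
  \<open>\<xi>\<close> as an exceptional point leaves one formula on each side.\<close>

lemma has_integral_abs_diff:
  fixes a b \<xi> :: real
  assumes "a \<le> b"
  shows "((\<lambda>t. \<bar>t - \<xi>\<bar>) has_integral ((b - \<xi>) * \<bar>b - \<xi>\<bar> - (a - \<xi>) * \<bar>a - \<xi>\<bar>) / 2) {a..b}"
proof -
  have "((\<lambda>t. (t - \<xi>) * \<bar>t - \<xi>\<bar> / 2) has_real_derivative \<bar>t - \<xi>\<bar>) (at t)" if "t \<noteq> \<xi>" for t
  proof (cases "\<xi> < t")
    case True
    have "((\<lambda>t. (t - \<xi>) * (t - \<xi>) / 2) has_real_derivative \<bar>t - \<xi>\<bar>) (at t)"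
      using True by (auto intro!: derivative_eq_intros)
    then show ?thesis
      by (rule has_field_derivative_transform_within_open[where S = "{\<xi><..}"]) (use True in auto)
  next
    case False
    have "((\<lambda>t. (t - \<xi>) * (\<xi> - t) / 2) has_real_derivative \<bar>t - \<xi>\<bar>) (at t)"
      using False by (auto intro!: derivative_eq_intros)
    then show ?thesis
      by (rule has_field_derivative_transform_within_open[where S = "{..<\<xi>}"]) (use False that in auto)
  qed
  then have "((\<lambda>t. \<bar>t - \<xi>\<bar>) has_integral
      (b - \<xi>) * \<bar>b - \<xi>\<bar> / 2 - (a - \<xi>) * \<bar>a - \<xi>\<bar> / 2) {a..b}"
    using assms
    by (intro fundamental_theorem_of_calculus_interior_strong[where S = "{\<xi>}"])
      (auto simp flip: has_real_derivative_iff_has_vector_derivative intro!: continuous_intros)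
  then show ?thesis by (simp add: diff_divide_distrib)
qed

lemma cell_estimates:
  fixes v g d :: "real \<Rightarrow> real"
  assumes "a < b" "continuous_on {a..b} v" "v a = 0" "v b = 0"
    and v: "\<And>t. a < t \<Longrightarrow> t < b \<Longrightarrow> (v has_real_derivative g t) (at t)"
    and g: "\<And>t. a < t \<Longrightarrow> t < b \<Longrightarrow> (g has_real_derivative d t) (at t)"
    and d: "\<And>t. a < t \<Longrightarrow> t < b \<Longrightarrow> \<bar>d t\<bar> \<le> M" and "0 \<le> M"
  shows "t \<in> {a..b} \<Longrightarrow> \<bar>v t\<bar> \<le> M * (b - a)\<^sup>2 / 2"
    and "(\<lambda>t. \<bar>g t\<bar>) integrable_on {a..b} \<Longrightarrow> integral {a..b} (\<lambda>t. \<bar>g t\<bar>) \<le> M * (b - a)\<^sup>2 / 2"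
proof -
  obtain \<xi> where \<xi>: "a < \<xi>" "\<xi> < b" and
    le: "\<And>t. a < t \<Longrightarrow> t < b \<Longrightarrow> \<bar>g t\<bar> \<le> M * \<bar>t - \<xi>\<bar>"
    using abs_deriv_le_Rolle[OF assms(1,2) _ v g d] assms(3,4) by metis
  have gM: "\<bar>g t\<bar> \<le> M * (b - a)" if "a < t" "t < b" for t
  proof -
    have "M * \<bar>t - \<xi>\<bar> \<le> M * (b - a)"
      using \<xi> that \<open>0 \<le> M\<close> by (intro mult_left_mono) auto
    then show ?thesis using le[OF that] by simp
  qed
  show "\<bar>v t\<bar> \<le> M * (b - a)\<^sup>2 / 2" if "t \<in> {a..b}"
  proof (cases "2 * t \<le> a + b") \<comment> \<open>compare with the nearer end, at distance at most \<open>(b - a) / 2\<close>\<close>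
    case True
    have "\<bar>v t - v a\<bar> \<le> M * (b - a) * (t - a)"
      using that \<open>a < b\<close> True
      by (intro abs_diff_le_mvt[where f' = g] continuous_on_subset[OF assms(2)] v gM) auto
    also have "\<dots> \<le> M * (b - a) * ((b - a) / 2)"
      using True \<open>a < b\<close> \<open>0 \<le> M\<close> by (intro mult_left_mono) auto
    finally show ?thesis using \<open>v a = 0\<close> by (simp add: power2_eq_square)
  next
    case False
    have "\<bar>v b - v t\<bar> \<le> M * (b - a) * (b - t)"
      using that \<open>a < b\<close> False
      by (intro abs_diff_le_mvt[where f' = g] continuous_on_subset[OF assms(2)] v gM) auto
    also have "\<dots> \<le> M * (b - a) * ((b - a) / 2)"
      using False \<open>a < b\<close> \<open>0 \<le> M\<close> by (intro mult_left_mono) auto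
    finally show ?thesis using \<open>v b = 0\<close> by (simp add: power2_eq_square)
  qed
  show "integral {a..b} (\<lambda>t. \<bar>g t\<bar>) \<le> M * (b - a)\<^sup>2 / 2"
    if int: "(\<lambda>t. \<bar>g t\<bar>) integrable_on {a..b}"
  proof -
    note I = has_integral_mult_right[OF has_integral_abs_diff[OF less_imp_le[OF \<open>a < b\<close>]], of M \<xi>]
    \<comment> \<open>The pointwise bound is available only in the open cell.\<close>
    have "integral {a..b} (\<lambda>t. \<bar>g t\<bar>) = integral {a<..<b} (\<lambda>t. \<bar>g t\<bar>)"
      by (simp add: integral_open_interval_real)
    also have "\<dots> \<le> integral {a<..<b} (\<lambda>t. M * \<bar>t - \<xi>\<bar>)"
      using int I le by (intro integral_le) (auto simp: integrable_on_open_interval_real)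
    also have "\<dots> = integral {a..b} (\<lambda>t. M * \<bar>t - \<xi>\<bar>)"
      by (simp add: integral_open_interval_real)
    also have "\<dots> = M * (((b - \<xi>)\<^sup>2 + (\<xi> - a)\<^sup>2) / 2)"
      using \<xi> I by (subst integral_unique[OF I]) (simp add: power2_eq_square algebra_simps)
    also have "\<dots> \<le> M * ((b - a)\<^sup>2 / 2)"
    proof -
      \<comment> \<open>The sum of the squares of the two parts is at most the square of the whole,
        since the cross term is nonnegative.\<close>
      have "(b - \<xi>)\<^sup>2 + (\<xi> - a)\<^sup>2 + 2 * ((b - \<xi>) * (\<xi> - a)) = (b - a)\<^sup>2"
        by (simp add: power2_eq_square algebra_simps)
      moreover have "0 \<le> (b - \<xi>) * (\<xi> - a)" using \<xi> by simp
      ultimately show ?thesis using \<open>0 \<le> M\<close> by (intro mult_left_mono) auto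
    qed
    finally show ?thesis by simp
  qed
qed

section \<open>Meshes and the interpolation error\<close>

lemma mesh_mono:
  assumes "mesh N x" "i \<le> j" "j \<le> N + 1"
  shows "x i \<le> x j"
  using assms(2,3)
proof (induction j rule: dec_induct)
  case (step j)
  then show ?case using assms(1) by (force simp: mesh_def)
qed simp

lemma mesh_cell_bounds:
  assumes "mesh N x" "i \<le> N"
  shows "0 \<le> x i" "x i < x (i + 1)" "x (i + 1) \<le> 1"
  using assms mesh_mono[of N x 0 i] mesh_mono[of N x "i + 1" "N + 1"] by (auto simp: mesh_def)

lemma mesh_cellE:
  assumes "mesh N x" "t \<in> {0..1}"
  obtains i where "i \<le> N" "t \<in> {x i..x (i + 1)}"
proof -
  have "\<exists>i\<le>k. t \<in> {x i..x (i + 1)}" if "t \<le> x (k + 1)" for k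
    using that
  proof (induction k)
    case 0
    then show ?case using assms by (auto simp: mesh_def)
  next
    case (Suc k)
    then show ?case
      by (cases "t \<le> x (k + 1)") (auto intro: le_SucI)
  qed
  from this[of N] that show ?thesis using assms by (auto simp: mesh_def)
qed

lemma mesh_step_le:
  assumes "i \<le> N"
  shows "x (i + 1) - x i \<le> mesh_size N x"
  unfolding mesh_size_def using assms by (intro Max_ge) auto

text \<open>Strictly inside a cell exactly one indicator is nonzero. With \<open>s\<close> the
  slopes, the sum is an explicit formula for the derivative of the interpolant off the mesh
  points.\<close>

lemma sum_indicator_mesh:
  assumes "mesh N x" "i \<le> N" "x i < t" "t < x (i + 1)"
  shows "(\<Sum>j\<le>N. s j * indicator {x j..<x (j + 1)} t) = (s i :: real)"
proof -
  have "indicator {x j..<x (j + 1)} t = (if j = i then 1 else 0 :: real)" if "j \<le> N" for j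
  proof -
    consider "j < i" | "j = i" | "i < j" by linarith
    then show ?thesis
    proof cases
      case 1
      then have "x (j + 1) \<le> x i" using assms by (intro mesh_mono) auto
      then show ?thesis using 1 assms by (auto simp: indicator_def)
    next
      case 3
      then have "x (i + 1) \<le> x j" using assms that by (intro mesh_mono) auto
      then show ?thesis using 3 assms by (auto simp: indicator_def)
    qed (use assms in auto)
  qed
  then have "(\<Sum>j\<le>N. s j * indicator {x j..<x (j + 1)} t) = (\<Sum>j\<le>N. if j = i then s j else 0)"
    by (intro sum.cong) auto
  then show ?thesis using assms by simp
qed

text \<open>The cell bounds telescope to \<open>B\<close> times the total length, which is
  1.\<close>

lemma integral_mesh_le:
  fixes f :: "real \<Rightarrow> real"
  assumes mesh: "mesh N x" and f: "f integrable_on {0..1}"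
    and cell: "\<And>i. i \<le> N \<Longrightarrow> integral {x i..x (i + 1)} f \<le> B * (x (i + 1) - x i)"
  shows "integral {0..1} f \<le> B"
proof -
  have "integral {0..x k} f \<le> B * x k" if "k \<le> N + 1" for k
    using that
  proof (induction k)
    case 0
    then show ?case using mesh by (simp add: mesh_def)
  next
    case (Suc k)
    then have k: "k \<le> N" by simp
    note b = mesh_cell_bounds[OF mesh k]
    have "integral {0..x (Suc k)} f = integral {0..x k} f + integral {x k..x (Suc k)} f"
      using b by (intro Henstock_Kurzweil_Integration.integral_combine[symmetric]
          integrable_on_subinterval[OF f]) auto
    also have "\<dots> \<le> B * x k + B * (x (Suc k) - x k)"
      using Suc cell[OF k] by (intro add_mono) auto
    finally show ?case by (simp add: algebra_simps)
  qed
  from this[of "N + 1"] mesh show ?thesis by (simp add: mesh_def)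
qed

lemma poly_degree_le_1:
  assumes "degree p \<le> 1"
  shows "poly p t = coeff p 0 + coeff p 1 * t"
proof -
  have "p = [:coeff p 0, coeff p 1:]"
    using assms by (intro poly_eqI) (auto simp: coeff_pCons coeff_eq_0 split: nat.splits)
  then show ?thesis by (metis poly_pCons poly_0 mult_zero_right add_0_right mult.commute)
qed

lemma P1_interpolantE:
  assumes "P1_interpolant N x u u\<^sub>I"
  obtains c s where "\<And>i t. i \<le> N \<Longrightarrow> t \<in> {x i..x (i + 1)} \<Longrightarrow> u\<^sub>I t = c i + s i * t"
proof -
  have "\<forall>i. \<exists>p. i \<le> N \<longrightarrow> degree p \<le> 1 \<and> (\<forall>t\<in>{x i..x (i + 1)}. u\<^sub>I t = poly p t)"
    using assms unfolding P1_interpolant_def by blast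
  then obtain p where "\<And>i. i \<le> N \<Longrightarrow> degree (p i) \<le> 1"
    "\<And>i t. i \<le> N \<Longrightarrow> t \<in> {x i..x (i + 1)} \<Longrightarrow> u\<^sub>I t = poly (p i) t"
    by metis
  then have "u\<^sub>I t = coeff (p i) 0 + coeff (p i) 1 * t" if "i \<le> N" "t \<in> {x i..x (i + 1)}" for i t
    using that poly_degree_le_1 by metis
  then show ?thesis by (rule that)
qed

section \<open>The global error estimate for a pointwise bound on the second derivative\<close>

lemma interpolation_error:
  fixes u u' u'' u\<^sub>I :: "real \<Rightarrow> real"
  assumes u': "\<And>t. t \<in> {0..1} \<Longrightarrow> (u has_real_derivative u' t) (at t within {0..1})"
    and u'': "\<And>t. t \<in> {0..1} \<Longrightarrow> (u' has_real_derivative u'' t) (at t within {0..1})"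
    and M: "\<And>t. t \<in> {0..1} \<Longrightarrow> \<bar>u'' t\<bar> \<le> M"
    and mesh: "mesh N x"
    and interp: "P1_interpolant N x u u\<^sub>I"
  defines "h \<equiv> mesh_size N x"
  shows "(\<lambda>t. u t - u\<^sub>I t) \<in> W11" (is "?v \<in> _")
    and "norm_1_1 (\<lambda>t. u t - u\<^sub>I t) \<le> (h + h\<^sup>2) / 2 * M"
proof -
  obtain c s where uI: "\<And>i t. i \<le> N \<Longrightarrow> t \<in> {x i..x (i + 1)} \<Longrightarrow> u\<^sub>I t = c i + s i * t"
    using P1_interpolantE[OF interp] by blast
  \<comment> \<open>The classical derivative of the error off the mesh points, given by a single
    formula on the whole line so that integrability is immediate; its values at the mesh points do
    not matter.\<close>
  define g where "g t = u' t - (\<Sum>j\<le>N. s j * indicator {x j..<x (j + 1)} t)" for t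
  have M0: "0 \<le> M" using M[of 0] by simp
  have vcont: "continuous_on {0..1} ?v"
    using interp DERIV_continuous_on[OF u'] by (intro continuous_on_diff) (auto simp: P1_interpolant_def)
  have g_eq: "g t = u' t - s i" if "i \<le> N" "x i < t" "t < x (i + 1)" for i t
    using sum_indicator_mesh[OF mesh that] by (simp add: g_def)
  \<comment> \<open>The open cells lie in the interior of the unit interval, so the derivatives
    there are two-sided.\<close>
  have at: "at t within {0..1} = at t" if "i \<le> N" "x i < t" "t < x (i + 1)" for i t
    using mesh_cell_bounds[OF mesh that(1)] that by (intro at_within_interior) simp
  have v': "(?v has_real_derivative g t) (at t)" if t: "i \<le> N" "x i < t" "t < x (i + 1)" for i t
  proof -
    have "((\<lambda>t. u t - (c i + s i * t)) has_real_derivative g t) (at t)"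
      using u'[of t] at[OF t] mesh_cell_bounds[OF mesh t(1)] t
      by (auto intro!: derivative_eq_intros simp: g_eq[OF t])
    then show ?thesis
      by (rule has_field_derivative_transform_within_open[where S = "{x i<..<x (i + 1)}"])
        (use t in \<open>auto simp: uI\<close>)
  qed
  have g': "(g has_real_derivative u'' t) (at t)" if t: "i \<le> N" "x i < t" "t < x (i + 1)" for i t
  proof -
    have "((\<lambda>t. u' t - s i) has_real_derivative u'' t) (at t)"
      using u''[of t] at[OF t] mesh_cell_bounds[OF mesh t(1)] t
      by (auto intro!: derivative_eq_intros)
    then show ?thesis
      by (rule has_field_derivative_transform_within_open[where S = "{x i<..<x (i + 1)}"])
        (use t in \<open>auto simp: g_eq\<close>)
  qed
  have g_int: "g absolutely_integrable_on {0<..<1}"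
  proof -
    have "(\<lambda>t. indicator A t :: real) absolutely_integrable_on {0<..<1}" if "A \<in> sets lebesgue" for A :: "real set"
      using integrable_mult_indicator[OF that, of "indicator {0<..<1} :: real \<Rightarrow> real"]
      by (simp add: set_integrable_def mult.commute)
    moreover have "u' absolutely_integrable_on {0<..<1}"
      using absolutely_integrable_continuous_real[OF DERIV_continuous_on[OF u'']]
      by (simp add: absolutely_integrable_Ioo_iff)
    ultimately show ?thesis
      unfolding g_def[abs_def]
      by (intro set_integral_diff(1) absolutely_integrable_sum set_integrable_mult_right) auto
  qed
  have weak: "has_weak_deriv ?v g"
  proof (rule has_weak_deriv_piecewise[where S = "x ` {..N + 1}"])
    fix t assume t: "t \<in> {0<..<1} - x ` {..N + 1}"
    then obtain i where i: "i \<le> N" "t \<in> {x i..x (i + 1)}"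
      using mesh_cellE[OF mesh, of t] by auto
    have "t \<noteq> x i" "t \<noteq> x (i + 1)" using t i(1) by auto
    with i show "(?v has_real_derivative g t) (at t)" by (intro v'[of i]) auto
  qed (use vcont g_int in auto)
  then show "?v \<in> W11" by (auto simp: W11_def)
  have cell: "\<And>t. t \<in> {x i..x (i + 1)} \<Longrightarrow> \<bar>?v t\<bar> \<le> M * (x (i + 1) - x i)\<^sup>2 / 2"
    "(\<lambda>t. \<bar>g t\<bar>) integrable_on {x i..x (i + 1)} \<Longrightarrow>
      integral {x i..x (i + 1)} (\<lambda>t. \<bar>g t\<bar>) \<le> M * (x (i + 1) - x i)\<^sup>2 / 2"
    if i: "i \<le> N" for i
  proof -
    note b = mesh_cell_bounds[OF mesh i]
    have v0: "?v (x i) = 0" "?v (x (i + 1)) = 0"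
      using interp i by (auto simp: P1_interpolant_def)
    have cont: "continuous_on {x i..x (i + 1)} ?v"
      using b by (intro continuous_on_subset[OF vcont]) auto
    have bound: "\<bar>u'' t\<bar> \<le> M" if "x i < t" "t < x (i + 1)" for t
      using b that by (intro M) auto
    show "\<bar>?v t\<bar> \<le> M * (x (i + 1) - x i)\<^sup>2 / 2" if "t \<in> {x i..x (i + 1)}" for t
      by (rule cell_estimates(1)[OF b(2) cont v0 _ _ _ M0 that])
        (rule v'[OF i] g'[OF i] bound; assumption)+
    show "integral {x i..x (i + 1)} (\<lambda>t. \<bar>g t\<bar>) \<le> M * (x (i + 1) - x i)\<^sup>2 / 2"
      if "(\<lambda>t. \<bar>g t\<bar>) integrable_on {x i..x (i + 1)}"
      by (rule cell_estimates(2)[OF b(2) cont v0 _ _ _ M0 that])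
        (rule v'[OF i] g'[OF i] bound; assumption)+
  qed
  have step: "0 \<le> x (i + 1) - x i" "x (i + 1) - x i \<le> h" if "i \<le> N" for i
    using mesh_cell_bounds[OF mesh that] mesh_step_le[OF that, of x] by (auto simp: h_def)
  have "norm_0_1 ?v \<le> M * h\<^sup>2 / 2"
  proof -
    have "\<bar>?v t\<bar> \<le> M * h\<^sup>2 / 2" if t: "t \<in> {0..1}" for t
    proof -
      obtain i where i: "i \<le> N" "t \<in> {x i..x (i + 1)}"
        using mesh_cellE[OF mesh t] by blast
      have "\<bar>?v t\<bar> \<le> M * (x (i + 1) - x i)\<^sup>2 / 2" by (rule cell(1)[OF i])
      also have "\<dots> \<le> M * h\<^sup>2 / 2"
        using step[OF i(1)] M0 by (intro divide_right_mono mult_left_mono power_mono) auto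
      finally show ?thesis .
    qed
    then have "integral {0..1} (\<lambda>t. \<bar>?v t\<bar>) \<le> integral {0..1} (\<lambda>t::real. M * h\<^sup>2 / 2)"
      by (intro integral_le integrable_continuous_real continuous_on_rabs[OF vcont] continuous_on_const)
    then show ?thesis
      using weak by (subst norm_0_1_eq_Ioo(2)) (auto simp: has_weak_deriv_def)
  qed
  moreover have "norm_0_1 g \<le> M * h / 2"
  proof -
    have "g absolutely_integrable_on {0..1}"
      using g_int by (simp only: absolutely_integrable_Ioo_iff)
    then have "(\<lambda>t. \<bar>g t\<bar>) integrable_on {0..1}"
      by (simp add: absolutely_integrable_on_def)
    then have "integral {0..1} (\<lambda>t. \<bar>g t\<bar>) \<le> M * h / 2"
    proof (rule integral_mesh_le[OF mesh])
      fix i assume i: "i \<le> N"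
      have "integral {x i..x (i + 1)} (\<lambda>t. \<bar>g t\<bar>) \<le> M * (x (i + 1) - x i)\<^sup>2 / 2"
        using mesh_cell_bounds[OF mesh i]
        by (intro cell(2)[OF i] integrable_on_subinterval[OF \<open>(\<lambda>t. \<bar>g t\<bar>) integrable_on {0..1}\<close>]) auto
      \<comment> \<open>Only one factor is replaced by \<open>h\<close>; the other is kept because
        the cell lengths sum to 1. This yields order \<open>h\<close> instead of
        \<open>h^2\<close>.\<close>
      also have "\<dots> \<le> M * (h * (x (i + 1) - x i)) / 2"
        unfolding power2_eq_square
        using step[OF i] M0 by (intro divide_right_mono mult_left_mono mult_right_mono) auto
      finally show "integral {x i..x (i + 1)} (\<lambda>t. \<bar>g t\<bar>) \<le> M * h / 2 * (x (i + 1) - x i)"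
        by simp
    qed
    then show ?thesis using g_int by (simp add: norm_0_1_eq_Ioo(2))
  qed
  ultimately have "norm_0_1 ?v + norm_0_1 g \<le> M * h\<^sup>2 / 2 + M * h / 2"
    by (rule add_mono)
  also have "\<dots> = (h + h\<^sup>2) / 2 * M"
    by (simp add: field_simps)
  finally show "norm_1_1 ?v \<le> (h + h\<^sup>2) / 2 * M"
    by (simp add: norm_1_1_def norm_0_1_weak_deriv[OF weak])
qed

theorem theorem3p2:
  fixes u u' u'' u\<^sub>I :: "real \<Rightarrow> real" and m\<^sub>2 M\<^sub>2 h :: real
    and N :: nat and x :: "nat \<Rightarrow> real"
  assumes u': "\<And>t. t \<in> {0..1} \<Longrightarrow> (u has_real_derivative u' t) (at t within {0..1})"
    and u'': "\<And>t. t \<in> {0..1} \<Longrightarrow> (u' has_real_derivative u'' t) (at t within {0..1})"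
    and cont: "continuous_on {0..1} u''"
    and bounds: "\<And>t. t \<in> {0..1} \<Longrightarrow> m\<^sub>2 \<le> u'' t \<and> u'' t \<le> M\<^sub>2"
    and mesh: "mesh N x"
    and h: "h = mesh_size N x"
    and interp: "P1_interpolant N x u u\<^sub>I"
  shows "(\<lambda>t. u t - u\<^sub>I t) \<in> W11 \<and>
    (\<forall>n::nat. n \<ge> 1 \<longrightarrow>
       norm_1_1 (\<lambda>t. u t - u\<^sub>I t)
         \<le> (h + h^2) / 2 * norm_sup u'' + (h + h^2) / (8 * real n) * (M\<^sub>2 - m\<^sub>2)) \<and>
    norm_1_1 (\<lambda>t. u t - u\<^sub>I t) \<le> (h + h^2) / 2 * norm_sup u''"
proof -
  have le: "norm_1_1 (\<lambda>t. u t - u\<^sub>I t) \<le> (h + h^2) / 2 * norm_sup u''"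
    unfolding h using abs_le_norm_sup[OF cont] by (intro interpolation_error(2)[OF u' u'' _ mesh interp])
  have "0 \<le> h"
    using mesh_cell_bounds(2)[OF mesh, of 0] mesh_step_le[of 0 N x] by (simp add: h)
  moreover have "m\<^sub>2 \<le> M\<^sub>2" using bounds[of 0] by simp
  \<comment> \<open>The extra summand is nonnegative, so adding it only weakens the bound. At
    \<open>n = 0\<close> it is zero, division by zero being zero.\<close>
  ultimately have "0 \<le> (h + h^2) / (8 * real n) * (M\<^sub>2 - m\<^sub>2)" for n :: nat
    by simp
  then have "norm_1_1 (\<lambda>t. u t - u\<^sub>I t)
      \<le> (h + h^2) / 2 * norm_sup u'' + (h + h^2) / (8 * real n) * (M\<^sub>2 - m\<^sub>2)" for n :: nat
    using le by (rule add_increasing2)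
  moreover have "(\<lambda>t. u t - u\<^sub>I t) \<in> W11"
    by (rule interpolation_error(1)[OF u' u'' abs_le_norm_sup[OF cont] mesh interp])
  ultimately show ?thesis using le by blast
qed

end
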